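(* In a reduced graph $G$, any two holes $H_1,H_2$ are congenial, i.e., $H_1\subseteq N[H_2]$ and $H_2\subseteq N[H_1]$.
   Context: Graphs are finite, simple, undirected. A hole is an induced (chordless) cycle with at least $4$ vertices; we identify it with its vertex set. For $U\subseteq V(G)$, $N[U]=\bigcup_{v\in U}N[v]$ where $N[v]$ is the closed neighborhood. A set $X\subseteq V(G)$ is a minimal forbidden set if $G[X]$ is not an interval graph but every proper subset induces an interval graph. A graph is prereduced if it has no minimal forbidden set of at most $10$ vertices. A module is a set $M\subseteq V(G)$ such that all vertices of $M$ have the same neighbors outside $M$; it is nontrivial if $1<|M|<|V(G)|$. A graph is reduced if it is prereduced and every nontrivial module induces a clique. *)

theory Defs
  imports Complex_Main "Graph_Theory.Digraph_Component"
begin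

text \<open>
  Finite simple undirected graphs are the locale \<open>graph\<close> of the Graph Theory library: finite,
  loop-free, symmetric digraphs without parallel arcs. An undirected edge is a pair of opposite
  arcs, so \<open>u \<rightarrow>\<^bsub>G\<^esub> v\<close> is the (symmetric, irreflexive) adjacency relation, and \<open>G \<restriction> X\<close> is the
  induced subgraph \<open>G[X]\<close> for \<open>X \<subseteq> verts G\<close>.
\<close>

definition interval_graph :: "('a, 'b) pre_digraph \<Rightarrow> bool" where
  "interval_graph G \<longleftrightarrow>
     (\<exists>l r :: 'a \<Rightarrow> real.
        (\<forall>v \<in> verts G. l v \<le> r v) \<and>
        (\<forall>u \<in> verts G. \<forall>v \<in> verts G. u \<noteq> v \<longrightarrow>
           (u \<rightarrow>\<^bsub>G\<^esub> v \<longleftrightarrow> {l u..r u} \<inter> {l v..r v} \<noteq> {})))"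

definition minimal_forbidden_set :: "('a, 'b) pre_digraph \<Rightarrow> 'a set \<Rightarrow> bool" where
  "minimal_forbidden_set G X \<longleftrightarrow>
     X \<subseteq> verts G \<and> \<not> interval_graph (G \<restriction> X) \<and> (\<forall>Y. Y \<subset> X \<longrightarrow> interval_graph (G \<restriction> Y))"

definition prereduced :: "('a, 'b) pre_digraph \<Rightarrow> bool" where
  "prereduced G \<longleftrightarrow> \<not> (\<exists>X. minimal_forbidden_set G X \<and> card X \<le> 10)"

definition graph_module :: "('a, 'b) pre_digraph \<Rightarrow> 'a set \<Rightarrow> bool" where
  "graph_module G M \<longleftrightarrow>
     M \<subseteq> verts G \<and>
     (\<forall>u \<in> M. \<forall>v \<in> M. {w \<in> verts G - M. u \<rightarrow>\<^bsub>G\<^esub> w} = {w \<in> verts G - M. v \<rightarrow>\<^bsub>G\<^esub> w})"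

definition nontrivial_module :: "('a, 'b) pre_digraph \<Rightarrow> 'a set \<Rightarrow> bool" where
  "nontrivial_module G M \<longleftrightarrow> graph_module G M \<and> 1 < card M \<and> card M < card (verts G)"

definition clique :: "('a, 'b) pre_digraph \<Rightarrow> 'a set \<Rightarrow> bool" where
  "clique G K \<longleftrightarrow> K \<subseteq> verts G \<and> (\<forall>u \<in> K. \<forall>v \<in> K. u \<noteq> v \<longrightarrow> u \<rightarrow>\<^bsub>G\<^esub> v)"

definition reduced :: "('a, 'b) pre_digraph \<Rightarrow> bool" where
  "reduced G \<longleftrightarrow> prereduced G \<and> (\<forall>M. nontrivial_module G M \<longrightarrow> clique G M)"

text \<open>
  The list \<open>vs\<close> is a cyclic enumeration of the hole. In the equivalence, the
  left-to-right direction excludes chords and the right-to-left direction provides the cycle.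
\<close>

definition hole :: "('a, 'b) pre_digraph \<Rightarrow> 'a set \<Rightarrow> bool" where
  "hole G H \<longleftrightarrow>
     H \<subseteq> verts G \<and>
     (\<exists>vs. distinct vs \<and> set vs = H \<and> 4 \<le> length vs \<and>
        (\<forall>i < length vs. \<forall>j < length vs.
           vs ! i \<rightarrow>\<^bsub>G\<^esub> vs ! j \<longleftrightarrow>
             j = Suc i mod length vs \<or> i = Suc j mod length vs))"

definition closed_nbhd :: "('a, 'b) pre_digraph \<Rightarrow> 'a \<Rightarrow> 'a set" where
  "closed_nbhd G v = insert v {w. v \<rightarrow>\<^bsub>G\<^esub> w}"

definition closed_nbhd_set :: "('a, 'b) pre_digraph \<Rightarrow> 'a set \<Rightarrow> 'a set" where
  "closed_nbhd_set G U = (\<Union>v \<in> U. closed_nbhd G v)"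

definition congenial :: "('a, 'b) pre_digraph \<Rightarrow> 'a set \<Rightarrow> 'a set \<Rightarrow> bool" where
  "congenial G H\<^sub>1 H\<^sub>2 \<longleftrightarrow> H\<^sub>1 \<subseteq> closed_nbhd_set G H\<^sub>2 \<and> H\<^sub>2 \<subseteq> closed_nbhd_set G H\<^sub>1"

end

theory Submission
  imports Defs
begin

text \<open>
  Let \<open>H\<close> be a hole of a reduced graph, \<open>C\<close> the set of vertices adjacent to all of \<open>H\<close>, \<open>P\<close> the set
  of vertices outside \<open>H\<close> adjacent to some but not all of \<open>H\<close>, and call a vertex remote if it lies
  outside \<open>N[H]\<close>. Forbidding small long claws, nets, whipping tops, tents, \<open>C\<^sub>4\<close> and \<open>C\<^sub>5\<close> gives:
  if \<open>x \<in> P\<close> is adjacent to a remote \<open>y\<close>, then every neighbor of \<open>y\<close> is \<open>x\<close> or adjacent to \<open>x\<close>; and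
  every vertex of \<open>C\<close> is adjacent to all of \<open>H\<close>, \<open>P\<close> and the remote vertices adjacent to \<open>P\<close>. These
  three sets therefore form a module that is not a clique, so it is the whole graph and \<open>C\<close> is
  empty, for every hole \<open>H\<close>. If now a hole \<open>H\<^sub>1\<close> has a vertex remote from \<open>H\<^sub>2\<close>, then propagating
  the neighborhood property along the chordless cycle \<open>H\<^sub>1\<close> shows first that all of \<open>H\<^sub>1\<close> is remote
  from \<open>H\<^sub>2\<close> and then that a single \<open>x\<close> is adjacent to all of \<open>H\<^sub>1\<close>, a contradiction.
\<close>

section \<open>Small obstructions to interval models\<close>

locale prereduced_graph = graph +
  assumes prereduced: "prereduced G"
begin

abbreviation adj :: "'a \<Rightarrow> 'a \<Rightarrow> bool" (infix "\<sim>" 40) where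
  "u \<sim> v \<equiv> u \<rightarrow>\<^bsub>G\<^esub> v"

abbreviation apart :: "'a \<Rightarrow> 'a \<Rightarrow> bool" (infix "\<parallel>" 40) where
  "u \<parallel> v \<equiv> u \<noteq> v \<and> \<not> u \<sim> v"

lemma adj_commute: "u \<sim> v \<longleftrightarrow> v \<sim> u"
  using graph_symmetric by blast

lemma not_adj_self [simp]: "\<not> u \<sim> u"
  using adj_not_same by blast

lemma dominates_induce_iff:
  assumes "u \<in> X" "v \<in> X"
  shows "u \<rightarrow>\<^bsub>G \<restriction> X\<^esub> v \<longleftrightarrow> u \<sim> v"
  using assms by (auto simp: arcs_ends_conv)

text \<open>A non-interval induced subgraph contains a minimal forbidden set, by induction on proper
  subsets, and a small one is excluded. The model is handed out as endpoint inequalities so that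
  each obstruction below becomes a problem in linear arithmetic.\<close>

lemma small_interval_model:
  assumes "X \<subseteq> verts G" "card X \<le> 10"
  obtains l r :: "'a \<Rightarrow> real"
  where "\<And>u. u \<in> X \<Longrightarrow> l u \<le> r u"
    and "\<And>u v. u \<in> X \<Longrightarrow> v \<in> X \<Longrightarrow> u \<sim> v \<Longrightarrow> l u \<le> r v \<and> l v \<le> r u"
    and "\<And>u v. u \<in> X \<Longrightarrow> v \<in> X \<Longrightarrow> u \<parallel> v \<Longrightarrow> \<not> (l u \<le> r v \<and> l v \<le> r u)"
proof -
  have fin: "finite X"
    using assms(1) finite_subset finite_verts by blast
  have "interval_graph (G \<restriction> X)"
    using fin assms
  proof (induction X rule: finite_psubset_induct)
    case (psubset X)
    have "interval_graph (G \<restriction> Y)" if "Y \<subset> X" for Y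
      using psubset.IH[OF that] psubset.prems that psubset_card_mono[OF psubset.hyps that]
      by simp
    then have "\<not> interval_graph (G \<restriction> X) \<Longrightarrow> minimal_forbidden_set G X"
      using psubset.prems by (auto simp: minimal_forbidden_set_def)
    then show ?case
      using prereduced psubset.prems by (auto simp: prereduced_def)
  qed
  then obtain l r :: "'a \<Rightarrow> real" where lr: "\<forall>u \<in> X. l u \<le> r u"
    and "\<forall>u \<in> X. \<forall>v \<in> X. u \<noteq> v \<longrightarrow>
      (u \<rightarrow>\<^bsub>G \<restriction> X\<^esub> v \<longleftrightarrow> {l u..r u} \<inter> {l v..r v} \<noteq> {})"
    unfolding interval_graph_def induce_subgraph_verts by blast
  then have adj: "u \<sim> v \<longleftrightarrow> {l u..r u} \<inter> {l v..r v} \<noteq> {}"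
    if "u \<in> X" "v \<in> X" "u \<noteq> v" for u v
    using that dominates_induce_iff by metis
  have meet: "{l u..r u} \<inter> {l v..r v} \<noteq> {} \<longleftrightarrow> l u \<le> r v \<and> l v \<le> r u" if "u \<in> X" "v \<in> X" for u v
    using lr that by auto
  show thesis
  proof (rule that[of l r])
    show "l u \<le> r v \<and> l v \<le> r u" if "u \<in> X" "v \<in> X" "u \<sim> v" for u v
      using adj[of u v] meet[of u v] that by (metis not_adj_self)
    show "\<not> (l u \<le> r v \<and> l v \<le> r u)" if "u \<in> X" "v \<in> X" "u \<parallel> v" for u v
      using adj[of u v] meet[of u v] that by blast
  qed (use lr in blast)
qed

section \<open>Excluded patterns on at most seven vertices\<close>

lemma no_C4:
  assumes "a \<sim> b" "b \<sim> c" "c \<sim> d" "d \<sim> a" "a \<parallel> c" "b \<parallel> d"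
  shows False
proof -
  let ?X = "{a, b, c, d}"
  have "?X \<subseteq> verts G"
    using assms by (auto dest: adj_in_verts)
  moreover have "card ?X \<le> 10"
    by (auto simp: card_insert_if)
  ultimately obtain l r :: "'a \<Rightarrow> real" where
    "\<And>u v. u \<in> ?X \<Longrightarrow> v \<in> ?X \<Longrightarrow> u \<sim> v \<Longrightarrow> l u \<le> r v \<and> l v \<le> r u"
    "\<And>u v. u \<in> ?X \<Longrightarrow> v \<in> ?X \<Longrightarrow> u \<parallel> v \<Longrightarrow> \<not> (l u \<le> r v \<and> l v \<le> r u)"
    by (rule small_interval_model) blast
  \<comment> \<open>Each edge and nonedge becomes an endpoint condition. Here the intervals of
    \<open>b\<close> and \<open>d\<close> would both cover the gap between the disjoint intervals of
    \<open>a\<close> and \<open>c\<close>, hence meet.\<close>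
  note m = assms(1-4)[THEN this(1)[rotated 2]] assms(5-6)[THEN this(2)[rotated 2]]
  show False
    using m by simp linarith
qed

lemma no_C5:
  assumes "a \<sim> b" "b \<sim> c" "c \<sim> d" "d \<sim> e" "e \<sim> a"
    "a \<parallel> c" "a \<parallel> d" "b \<parallel> d" "b \<parallel> e" "c \<parallel> e"
  shows False
proof -
  let ?X = "{a, b, c, d, e}"
  have "?X \<subseteq> verts G"
    using assms by (auto dest: adj_in_verts)
  moreover have "card ?X \<le> 10"
    by (auto simp: card_insert_if)
  ultimately obtain l r :: "'a \<Rightarrow> real" where
    "\<And>u v. u \<in> ?X \<Longrightarrow> v \<in> ?X \<Longrightarrow> u \<sim> v \<Longrightarrow> l u \<le> r v \<and> l v \<le> r u"
    "\<And>u v. u \<in> ?X \<Longrightarrow> v \<in> ?X \<Longrightarrow> u \<parallel> v \<Longrightarrow> \<not> (l u \<le> r v \<and> l v \<le> r u)"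
    by (rule small_interval_model) blast
  note m = assms(1-5)[THEN this(1)[rotated 2]] assms(6-10)[THEN this(2)[rotated 2]]
  show False
    using m by simp linarith
qed

text \<open>The intervals of \<open>a\<close>, \<open>b\<close>, \<open>d\<close> are pairwise
  disjoint and all meet that of \<open>c\<close>. The middle one therefore lies inside
  \<open>c\<close>, and its leaf would meet \<open>c\<close>.\<close>

lemma no_long_claw:
  assumes "c \<sim> a" "a \<sim> a'" "c \<sim> b" "b \<sim> b'" "c \<sim> d" "d \<sim> d'"
    "c \<parallel> a'" "c \<parallel> b'" "c \<parallel> d'" "a \<parallel> b" "a \<parallel> d" "b \<parallel> d"
  shows False
proof -
  let ?X = "{a, b, c, d, a', b', d'}"
  have "?X \<subseteq> verts G"
    using assms by (auto dest: adj_in_verts)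
  moreover have "card ?X \<le> 10"
    by (auto simp: card_insert_if)
  ultimately obtain l r :: "'a \<Rightarrow> real" where
    "\<And>u v. u \<in> ?X \<Longrightarrow> v \<in> ?X \<Longrightarrow> u \<sim> v \<Longrightarrow> l u \<le> r v \<and> l v \<le> r u"
    "\<And>u v. u \<in> ?X \<Longrightarrow> v \<in> ?X \<Longrightarrow> u \<parallel> v \<Longrightarrow> \<not> (l u \<le> r v \<and> l v \<le> r u)"
    by (rule small_interval_model) blast
  note m = assms(1-6)[THEN this(1)[rotated 2]] assms(7-12)[THEN this(2)[rotated 2]]
  show False
    using m by simp linarith
qed

text \<open>Say \<open>b'\<close> is the middle one of the disjoint intervals \<open>a'\<close>,
  \<open>b'\<close>, \<open>c'\<close>. Then \<open>a\<close> and \<open>c\<close> miss it and lie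
  on opposite sides of it, so they cannot meet.\<close>

lemma no_net:
  assumes "a \<sim> b" "b \<sim> c" "c \<sim> a" "a \<sim> a'" "b \<sim> b'" "c \<sim> c'"
    "a \<parallel> b'" "a \<parallel> c'" "b \<parallel> a'" "b \<parallel> c'" "c \<parallel> a'" "c \<parallel> b'" "a' \<parallel> b'" "a' \<parallel> c'" "b' \<parallel> c'"
  shows False
proof -
  let ?X = "{a, b, c, a', b', c'}"
  have "?X \<subseteq> verts G"
    using assms by (auto dest: adj_in_verts)
  moreover have "card ?X \<le> 10"
    by (auto simp: card_insert_if)
  ultimately obtain l r :: "'a \<Rightarrow> real" where
    "\<And>u. u \<in> ?X \<Longrightarrow> l u \<le> r u"
    "\<And>u v. u \<in> ?X \<Longrightarrow> v \<in> ?X \<Longrightarrow> u \<sim> v \<Longrightarrow> l u \<le> r v \<and> l v \<le> r u"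
    "\<And>u v. u \<in> ?X \<Longrightarrow> v \<in> ?X \<Longrightarrow> u \<parallel> v \<Longrightarrow> \<not> (l u \<le> r v \<and> l v \<le> r u)"
    by (rule small_interval_model) blast
  \<comment> \<open>Nonempty intervals enter because the middle pendant has to separate its two
    sides.\<close>
  note m = this(1)[of a] this(1)[of b] this(1)[of c] this(1)[of a'] this(1)[of b'] this(1)[of c']
    assms(1-6)[THEN this(2)[rotated 2]] assms(7-15)[THEN this(3)[rotated 2]]
  show False
    using m by simp (smt (verit))
qed

text \<open>The middle one of the independent intervals \<open>a'\<close>, \<open>b'\<close>,
  \<open>c'\<close> is covered by the triangle vertex that meets the outer two, yet it is apart from
  that vertex.\<close>

lemma no_tent:
  assumes "a \<sim> b" "b \<sim> c" "c \<sim> a" "a' \<sim> b" "a' \<sim> c" "b' \<sim> a" "b' \<sim> c" "c' \<sim> a" "c' \<sim> b"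
    "a \<parallel> a'" "b \<parallel> b'" "c \<parallel> c'" "a' \<parallel> b'" "a' \<parallel> c'" "b' \<parallel> c'"
  shows False
proof -
  let ?X = "{a, b, c, a', b', c'}"
  have "?X \<subseteq> verts G"
    using assms by (auto dest: adj_in_verts)
  moreover have "card ?X \<le> 10"
    by (auto simp: card_insert_if)
  ultimately obtain l r :: "'a \<Rightarrow> real" where
    "\<And>u v. u \<in> ?X \<Longrightarrow> v \<in> ?X \<Longrightarrow> u \<sim> v \<Longrightarrow> l u \<le> r v \<and> l v \<le> r u"
    "\<And>u v. u \<in> ?X \<Longrightarrow> v \<in> ?X \<Longrightarrow> u \<parallel> v \<Longrightarrow> \<not> (l u \<le> r v \<and> l v \<le> r u)"
    by (rule small_interval_model) blast
  note m = assms(1-9)[THEN this(1)[rotated 2]] assms(10-15)[THEN this(2)[rotated 2]]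
  show False
    using m by simp linarith
qed

text \<open>Among the disjoint intervals \<open>a\<close>, \<open>c\<close>, \<open>e\<close> the
  middle one is \<open>c\<close>: \<open>b\<close> joins \<open>a\<close> to \<open>c\<close>
  avoiding \<open>e\<close>, and \<open>d\<close> joins \<open>c\<close> to \<open>e\<close>
  avoiding \<open>a\<close>. Hence \<open>z\<close> covers \<open>c\<close> and meets
  \<open>p\<close>.\<close>

lemma no_whipping_top:
  assumes "a \<sim> b" "b \<sim> c" "c \<sim> d" "d \<sim> e" "c \<sim> p"
    "z \<sim> a" "z \<sim> b" "z \<sim> c" "z \<sim> d" "z \<sim> e" "z \<parallel> p"
    "a \<parallel> c" "c \<parallel> e" "b \<parallel> d" "b \<parallel> p" "d \<parallel> p" "a \<parallel> d" "a \<parallel> e" "b \<parallel> e" "a \<parallel> p" "e \<parallel> p"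
  shows False
proof -
  let ?X = "{a, b, c, d, e, p, z}"
  have "?X \<subseteq> verts G"
    using assms by (auto dest: adj_in_verts)
  moreover have "card ?X \<le> 10"
    by (auto simp: card_insert_if)
  ultimately obtain l r :: "'a \<Rightarrow> real" where
    "\<And>u v. u \<in> ?X \<Longrightarrow> v \<in> ?X \<Longrightarrow> u \<sim> v \<Longrightarrow> l u \<le> r v \<and> l v \<le> r u"
    "\<And>u v. u \<in> ?X \<Longrightarrow> v \<in> ?X \<Longrightarrow> u \<parallel> v \<Longrightarrow> \<not> (l u \<le> r v \<and> l v \<le> r u)"
    by (rule small_interval_model) blast
  note m = assms(1-10)[THEN this(1)[rotated 2]] assms(11-21)[THEN this(2)[rotated 2]]
  show False
    using m by simp linarith
qed

section \<open>Holes and their neighborhoods\<close>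

text \<open>The start is chosen where \<open>P\<close> switches from false to true, so that with
  adjacency to a vertex as \<open>P\<close> a run of neighbors begins at position 1. Stating
  adjacency without \<open>mod\<close> makes it easy to decide at given positions.\<close>

lemma hole_enumeration:
  assumes "hole G H" "v \<in> H" "P v" "w \<in> H" "\<not> P w"
  obtains f where "f ` {..<card H} = H" "inj_on f {..<card H}" "\<not> P (f 0)" "P (f 1)"
    and "\<And>i j. i < card H \<Longrightarrow> j < card H \<Longrightarrow> f i \<sim> f j \<longleftrightarrow>
      j = Suc i \<or> i = Suc j \<or> i = 0 \<and> Suc j = card H \<or> j = 0 \<and> Suc i = card H"
proof -
  obtain vs where vs: "distinct vs" "set vs = H" "4 \<le> length vs"
    and adj: "\<And>i j. i < length vs \<Longrightarrow> j < length vs \<Longrightarrow>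
      vs ! i \<sim> vs ! j \<longleftrightarrow> j = Suc i mod length vs \<or> i = Suc j mod length vs"
    using assms(1) unfolding hole_def by blast
  define n where "n = length vs"
  have n: "card H = n" "4 \<le> n"
    using vs distinct_card by (fastforce simp: n_def)+
  define g where "g i = vs ! (i mod n)" for i
  obtain i\<^sub>0 j\<^sub>0 where i\<^sub>0: "i\<^sub>0 < n" "P (g i\<^sub>0)" and j\<^sub>0: "j\<^sub>0 < n" "\<not> P (g j\<^sub>0)"
    using assms(2-5) vs(2) unfolding g_def n_def by (metis in_set_conv_nth mod_less)
  \<comment> \<open>From \<open>j\<^sub>0\<close>, going \<open>i\<^sub>0 + (n - j\<^sub>0)\<close>
    steps around the cycle leads to \<open>i\<^sub>0\<close>. The least number \<open>t\<close> of
    steps reaching \<open>P\<close> is positive, and \<open>s\<close> is the position just before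
    the switch.\<close>
  have "P (g (j\<^sub>0 + (i\<^sub>0 + (n - j\<^sub>0))))"
    using i\<^sub>0 j\<^sub>0 by (simp add: g_def)
  then obtain t where t: "P (g (j\<^sub>0 + t))" "\<And>u. u < t \<Longrightarrow> \<not> P (g (j\<^sub>0 + u))"
    using exists_least_iff[of "\<lambda>t. P (g (j\<^sub>0 + t))"] by blast
  then obtain u where u: "t = Suc u"
    using j\<^sub>0 by (cases t) auto
  define s where "s = j\<^sub>0 + u"
  define f where "f i = g (i + s)" for i
  have cancel: "(a + s) mod n = (b + s) mod n \<longleftrightarrow> a mod n = b mod n" for a b
    using nat_le_linear[of a b]
    by (auto simp: mod_eq_dvd_iff_nat mod_eq_dvd_iff_nat[THEN eq_iff_swap])
  have g_eq: "g a = g b \<longleftrightarrow> a mod n = b mod n" for a b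
    using vs(1,3) unfolding g_def n_def
    by (subst nth_eq_iff_index_eq) (auto intro!: mod_less_divisor)
  have g_adj: "g a \<sim> g b \<longleftrightarrow> b mod n = Suc a mod n \<or> a mod n = Suc b mod n" for a b
    using adj[of "a mod n" "b mod n"] n unfolding g_def n_def
    by (metis mod_Suc_eq mod_less_divisor less_le_trans zero_less_numeral)
  have inj: "inj_on f {..<n}"
    by (auto simp: inj_on_def f_def g_eq cancel)
  have "f ` {..<n} \<subseteq> H"
    using vs(2,3) by (auto simp: f_def g_def n_def intro!: nth_mem mod_less_divisor)
  moreover have "card (f ` {..<n}) = card H"
    using inj n by (simp add: card_image)
  ultimately have img: "f ` {..<n} = H"
    using vs(2) by (metis List.finite_set card_subset_eq)
  have Suc_mod: "j mod n = Suc i mod n \<longleftrightarrow> j = Suc i \<or> j = 0 \<and> Suc i = n"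
    if "i < n" "j < n" for i j
    using that by (cases "Suc i = n") auto
  have f_adj: "f i \<sim> f j \<longleftrightarrow> j = Suc i \<or> i = Suc j \<or> i = 0 \<and> Suc j = n \<or> j = 0 \<and> Suc i = n"
    if "i < n" "j < n" for i j
    using g_adj[of "i + s" "j + s"] cancel[of j "Suc i"] cancel[of i "Suc j"]
      Suc_mod[of i j] Suc_mod[of j i] that
    unfolding f_def by auto
  show thesis
    using that[of f] img inj f_adj t u n by (simp add: f_def s_def)
qed

lemma hole_card_ge_4: "hole G H \<Longrightarrow> 4 \<le> card H"
  unfolding hole_def using distinct_card by fastforce

text \<open>With \<open>v\<close> in position 1, its neighbors are positions 0 and 2, which are
  apart because the hole has at least four vertices; \<open>w\<close> is the one other than
  \<open>u\<close>.\<close>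

lemma hole_next:
  assumes "hole G H" "u \<in> H" "v \<in> H" "u \<sim> v"
  obtains w where "w \<in> H" "v \<sim> w" "u \<parallel> w"
proof -
  have n: "4 \<le> card H"
    using assms(1) by (rule hole_card_ge_4)
  have "u \<noteq> v"
    using assms(4) by auto
  then obtain f where img: "f ` {..<card H} = H" and inj: "inj_on f {..<card H}" and f1: "f 1 = v"
    and adj: "\<And>i j. i < card H \<Longrightarrow> j < card H \<Longrightarrow> f i \<sim> f j \<longleftrightarrow>
      j = Suc i \<or> i = Suc j \<or> i = 0 \<and> Suc j = card H \<or> j = 0 \<and> Suc i = card H"
    using hole_enumeration[of H v "\<lambda>u. u = v" u] assms by metis
  obtain i where i: "i < card H" "u = f i"
    using img assms(2) by auto
  then have "i = 0 \<or> i = 2"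
    using adj[of i 1] assms(4) f1 n by auto
  moreover have "f 0 \<in> H" "f 2 \<in> H"
    using img n by auto
  moreover have "f 0 \<parallel> f 2" "f 2 \<parallel> f 0"
    using adj[of 0 2] adj[of 2 0] inj_onD[OF inj, of 0 2] n by auto
  moreover have "v \<sim> f 0" "v \<sim> f 2"
    using adj[of 1 0] adj[of 1 2] f1 n by auto
  ultimately show thesis
    using that i(2) by blast
qed

text \<open>Connectedness of the cycle in the form used for propagation: a property spreads over a
  hole once no edge leads out of it.\<close>

lemma hole_boundary_edge:
  assumes "hole G H" "v \<in> H" "P v" "w \<in> H" "\<not> P w"
  obtains p q where "p \<in> H" "q \<in> H" "p \<sim> q" "P p" "\<not> P q"
proof -
  have n: "4 \<le> card H"
    using assms(1) by (rule hole_card_ge_4)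
  obtain f where "f ` {..<card H} = H" "\<not> P (f 0)" "P (f 1)"
    and "\<And>i j. i < card H \<Longrightarrow> j < card H \<Longrightarrow> f i \<sim> f j \<longleftrightarrow>
      j = Suc i \<or> i = Suc j \<or> i = 0 \<and> Suc j = card H \<or> j = 0 \<and> Suc i = card H"
    using hole_enumeration[OF assms] by metis
  then show thesis
    using that[of "f 1" "f 0"] n by force
qed

lemma hole_neighbors:
  assumes "hole G H" "v \<in> H"
  obtains p q where "p \<in> H" "q \<in> H" "v \<sim> p" "v \<sim> q" "p \<parallel> q"
proof -
  have "\<not> H \<subseteq> {v}"
    using hole_card_ge_4[OF assms(1)] card_mono[of "{v}" H] by auto
  then obtain w where "w \<in> H" "w \<noteq> v"
    by blast
  then obtain p where "p \<in> H" "v \<sim> p"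
    using hole_boundary_edge[of H v "\<lambda>u. u = v" w] assms by metis
  then show thesis
    using hole_next[of H p v] that assms adj_commute by metis
qed

text \<open>In an interval model the neighbors of the interval that ends first pairwise intersect.\<close>

lemma hole_card_gt_10:
  assumes "hole G H"
  shows "10 < card H"
proof (rule ccontr)
  assume small: "\<not> ?thesis"
  have sub: "H \<subseteq> verts G" and "finite H" "H \<noteq> {}"
    using assms hole_card_ge_4[of H] by (auto simp: hole_def)
  from sub obtain l r :: "'a \<Rightarrow> real" where
    m: "\<And>u v. u \<in> H \<Longrightarrow> v \<in> H \<Longrightarrow> u \<sim> v \<Longrightarrow> l u \<le> r v \<and> l v \<le> r u"
      "\<And>u v. u \<in> H \<Longrightarrow> v \<in> H \<Longrightarrow> u \<parallel> v \<Longrightarrow> \<not> (l u \<le> r v \<and> l v \<le> r u)"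
    using small_interval_model[of H] small by (metis not_less)
  obtain v where v: "v \<in> H" "\<And>u. u \<in> H \<Longrightarrow> r v \<le> r u"
    using \<open>finite H\<close> \<open>H \<noteq> {}\<close> ex_min_if_finite[of "r ` H"] by (metis arg_min_if_finite(1) arg_min_least)
  obtain p q where "p \<in> H" "q \<in> H" "v \<sim> p" "v \<sim> q" "p \<parallel> q"
    using hole_neighbors assms v(1) by metis
  then show False
    using m(1)[of v p] m(1)[of v q] m(2)[of p q] v by force
qed

section \<open>Vertices classified by their adjacency to a hole\<close>

definition partial_nbrs :: "'a set \<Rightarrow> 'a set" where
  "partial_nbrs H = {x. x \<notin> H \<and> (\<exists>h \<in> H. x \<sim> h) \<and> (\<exists>h \<in> H. \<not> x \<sim> h)}"

text \<open>The set is not restricted to \<open>verts G\<close>; membership in the graph comes from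
  adjacency where it is needed.\<close>

definition remote :: "'a set \<Rightarrow> 'a set" where
  "remote H = {y. \<forall>h \<in> H. y \<parallel> h}"

definition common_nbrs :: "'a set \<Rightarrow> 'a set" where
  "common_nbrs H = {c. \<forall>h \<in> H. c \<sim> h}"

text \<open>The cases follow the length of one maximal run of neighbors of \<open>x\<close> along
  the hole: one, two, or more. In \<open>far\<close>, \<open>b\<close> and \<open>c\<close> are the
  ends of the run and \<open>a\<close>, \<open>d\<close> the vertices just beyond them.\<close>

lemma partial_nbrs_cases:
  assumes "hole G H" "x \<in> partial_nbrs H"
  obtains
    (single) a b c d e where "{a, b, c, d, e} \<subseteq> H" "a \<sim> b" "b \<sim> c" "c \<sim> d" "d \<sim> e"
      "a \<parallel> c" "a \<parallel> d" "a \<parallel> e" "b \<parallel> d" "b \<parallel> e" "c \<parallel> e"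
      "x \<sim> c" "x \<parallel> a" "x \<parallel> b" "x \<parallel> d" "x \<parallel> e"
  | (double) a b c d where "{a, b, c, d} \<subseteq> H" "a \<sim> b" "b \<sim> c" "c \<sim> d"
      "a \<parallel> c" "a \<parallel> d" "b \<parallel> d" "x \<sim> b" "x \<sim> c" "x \<parallel> a" "x \<parallel> d"
  | (far) a b c d where "{a, b, c, d} \<subseteq> H" "a \<sim> b" "c \<sim> d"
      "a \<parallel> c" "a \<parallel> d" "b \<parallel> c" "b \<parallel> d" "x \<sim> b" "x \<sim> c" "x \<parallel> a" "x \<parallel> d"
proof -
  define n where "n = card H"
  have n: "10 < n"
    using assms(1) hole_card_gt_10 by (simp add: n_def)
  obtain v w where "v \<in> H" "x \<sim> v" "w \<in> H" "\<not> x \<sim> w" and x: "x \<notin> H"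
    using assms(2) by (auto simp: partial_nbrs_def)
  then obtain f where img: "f ` {..<n} = H" and inj: "inj_on f {..<n}"
    and f01: "\<not> x \<sim> f 0" "x \<sim> f 1"
    and adj: "\<And>i j. i < n \<Longrightarrow> j < n \<Longrightarrow> f i \<sim> f j \<longleftrightarrow>
      j = Suc i \<or> i = Suc j \<or> i = 0 \<and> Suc j = n \<or> j = 0 \<and> Suc i = n"
    using hole_enumeration[of H v "\<lambda>u. x \<sim> u" w] assms(1) unfolding n_def by metis
  have f_H: "f i \<in> H" if "i < n" for i
    using img that by auto
  have f_eq: "f i = f j \<longleftrightarrow> i = j" if "i < n" "j < n" for i j
    using inj that by (auto simp: inj_on_def)
  have x_neq: "x \<noteq> f i" if "i < n" for i
    using f_H that x by metis
  have x_comm: "f i \<sim> x \<longleftrightarrow> x \<sim> f i" for i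
    using adj_commute by blast
  \<comment> \<open>The least element \<open>k\<close> of \<open>A\<close> ends the run that starts
    at position 1. The disjunct \<open>Suc k = n\<close> guarantees that \<open>A\<close> is
    nonempty.\<close>
  define A where "A = {k. 1 \<le> k \<and> (Suc k = n \<or> \<not> x \<sim> f (Suc k))}"
  have "n - 1 \<in> A"
    using n by (simp add: A_def)
  then obtain k where k: "k \<in> A" "\<And>j. j < k \<Longrightarrow> j \<notin> A" "k \<le> n - 1"
    using exists_least_iff[of "\<lambda>k. k \<in> A"] by (metis not_less)
  have k1: "1 \<le> k" and kn: "k < n" and x_Suc_k: "Suc k < n \<Longrightarrow> \<not> x \<sim> f (Suc k)"
    using k(1,3) n by (auto simp: A_def)
  have xk: "x \<sim> f k"
  proof (cases "k = 1")
    case False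
    then have "k - 1 \<notin> A" "1 \<le> k - 1" "Suc (k - 1) = k"
      using k(2) k1 by auto
    then show ?thesis
      by (auto simp: A_def)
  qed (use f01 in simp)
  note simps = adj f_eq f_H x_neq x_comm
  \<comment> \<open>For \<open>3 \<le> k\<close> the question is how \<open>f k\<close> reaches
    \<open>f 0\<close> going forward: an edge closes a \<open>C4\<close> through \<open>x\<close>,
    two edges close a \<open>C5\<close>, and otherwise \<open>f 0\<close> and
    \<open>f (Suc k)\<close> are apart.\<close>
  consider "k = 1" | "k = 2" | "3 \<le> k" "Suc k = n" | "3 \<le> k" "Suc (Suc k) = n" | "3 \<le> k" "Suc (Suc k) < n"
    using kn k1 by linarith
  then show thesis
  proof cases
    case 1
    then have x2: "\<not> x \<sim> f 2"
      using x_Suc_k n by (simp add: numeral_2_eq_2)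
    have x3: "\<not> x \<sim> f 3"
    proof
      assume "x \<sim> f 3"
      then show False
        using f01 x2 n by (intro no_C4[of x "f 1" "f 2" "f 3"]) (simp_all add: simps)
    qed
    \<comment> \<open>\<open>f m\<close> is the last position, the other neighbor of
      \<open>f 0\<close> on the cycle.\<close>
    obtain m where m: "n = Suc m" "10 \<le> m"
      using n by (cases n) auto
    have xm: "\<not> x \<sim> f m"
    proof
      assume "x \<sim> f m"
      then show False
        using f01 m by (intro no_C4[of x "f 1" "f 0" "f m"]) (simp_all add: simps)
    qed
    show thesis
      using m f01 x2 x3 xm
      by (intro single[of "f m" "f 0" "f 1" "f 2" "f 3"]) (simp_all add: simps)
  next
    case 2
    then have "\<not> x \<sim> f 3"
      using x_Suc_k n by (simp add: numeral_3_eq_3 numeral_2_eq_2)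
    then show thesis
      using n f01 xk 2
      by (intro double[of "f 0" "f 1" "f 2" "f 3"]) (simp_all add: simps)
  next
    case 3
    then have False
      using f01 xk n kn by (intro no_C4[of x "f 1" "f 0" "f k"]) (simp_all add: simps)
    then show thesis ..
  next
    case 4
    then have False
      using f01 xk n kn x_Suc_k
      by (intro no_C5[of x "f 1" "f 0" "f (Suc k)" "f k"]) (simp_all add: simps)
    then show thesis ..
  next
    case 5
    then show thesis
      using n f01 xk kn x_Suc_k
      by (intro far[of "f 0" "f 1" "f k" "f (Suc k)"]) (simp_all add: simps)
  qed
qed

section \<open>The module generated by a hole\<close>

text \<open>The remote neighbor \<open>y\<close> turns the single case into a long claw centered at
  \<open>c\<close> and the double case into a net on the triangle \<open>x\<close>,
  \<open>b\<close>, \<open>c\<close>.\<close>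

lemma partial_nbrs_remote_far:
  assumes "hole G H" "x \<in> partial_nbrs H" "y \<in> remote H" "x \<sim> y"
  obtains a b c d where "{a, b, c, d} \<subseteq> H" "a \<sim> b" "c \<sim> d"
      "a \<parallel> c" "a \<parallel> d" "b \<parallel> c" "b \<parallel> d" "x \<sim> b" "x \<sim> c" "x \<parallel> a" "x \<parallel> d"
  using assms(1,2)
proof (cases rule: partial_nbrs_cases)
  case (single a b c d e)
  then have "y \<parallel> c"
    using assms(3) by (auto simp: remote_def)
  then show thesis
    using no_long_claw[of c b a d e x y] single assms(4) adj_commute by metis
next
  case (double a b c d)
  then have "y \<parallel> a" "y \<parallel> b" "y \<parallel> c" "y \<parallel> d"
    using assms(3) by (auto simp: remote_def)
  then show thesis
    using no_net[of x b c y a d] double assms(4) adj_commute by metis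
next
  case (far a b c d)
  then show thesis
    by (rule that)
qed

text \<open>Otherwise \<open>x\<close> is the center of a long claw with legs
  \<open>y\<close>-\<open>w\<close>, \<open>b\<close>-\<open>a\<close> and
  \<open>c\<close>-\<open>d\<close>, the last two taken from the \<open>far\<close> pattern.\<close>

lemma remote_nbr_subset:
  assumes "hole G H" "x \<in> partial_nbrs H" "y \<in> remote H" "x \<sim> y" "y \<sim> w" "w \<noteq> x"
  shows "x \<sim> w"
proof (rule ccontr)
  assume "\<not> x \<sim> w"
  from assms(1-4) obtain a b c d where far: "{a, b, c, d} \<subseteq> H" "a \<sim> b" "c \<sim> d"
      "a \<parallel> c" "a \<parallel> d" "b \<parallel> c" "b \<parallel> d" "x \<sim> b" "x \<sim> c" "x \<parallel> a" "x \<parallel> d"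
    by (rule partial_nbrs_remote_far)
  have y: "y \<parallel> a" "y \<parallel> b" "y \<parallel> c" "y \<parallel> d"
    using far(1) assms(3) by (auto simp: remote_def)
  have w: "x \<parallel> w" "w \<notin> H"
    using \<open>\<not> x \<sim> w\<close> assms(3,5,6) by (auto simp: remote_def)
  have "\<not> w \<sim> b" "\<not> w \<sim> c"
    using no_C4[of x y w b] no_C4[of x y w c] w y far assms(4,5) adj_commute by metis+
  moreover have "w \<noteq> b" "w \<noteq> c"
    using w far(1) by auto
  ultimately have "\<not> w \<sim> a" "\<not> w \<sim> d"
    using no_C5[of x y w a b] no_C5[of x y w d c] w y far assms(4,5) adj_commute by metis+
  then show False
    using no_long_claw[of x y w b a c d] w y far assms(4,5) adj_commute by metis
qed

text \<open>A nonadjacent \<open>z\<close> completes the three patterns of \<open>x\<close> to a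
  whipping top, a tent and a \<open>C4\<close>, respectively.\<close>

lemma common_nbrs_adj_partial_nbrs:
  assumes "hole G H" "z \<in> common_nbrs H" "x \<in> partial_nbrs H"
  shows "z \<sim> x"
proof (rule ccontr)
  assume "\<not> z \<sim> x"
  moreover have "z \<noteq> x"
    using assms(2,3) by (auto simp: common_nbrs_def partial_nbrs_def)
  ultimately have zx: "z \<parallel> x" "x \<parallel> z"
    using adj_commute by blast+
  have z: "z \<sim> h" "h \<sim> z" if "h \<in> H" for h
    using assms(2) that adj_commute by (auto simp: common_nbrs_def)
  from assms(1,3) show False
  proof (cases rule: partial_nbrs_cases)
    case (single a b c d e)
    then show False
      using no_whipping_top[of a b c d e x z] z zx adj_commute by (metis insert_subset)
  next
    case (double a b c d)
    then show False
      using no_tent[of z b c x d a] z zx adj_commute by (metis insert_subset)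
  next
    case (far a b c d)
    then show False
      using no_C4[of x b z c] z zx adj_commute by (metis insert_subset)
  qed
qed

text \<open>Otherwise \<open>z\<close>, the path \<open>a\<close>, \<open>b\<close>,
  \<open>x\<close>, \<open>c\<close>, \<open>d\<close> and the pendant \<open>y\<close> at
  \<open>x\<close> form a whipping top.\<close>

lemma common_nbrs_adj_remote:
  assumes "hole G H" "z \<in> common_nbrs H" "x \<in> partial_nbrs H" "y \<in> remote H" "x \<sim> y"
  shows "z \<sim> y"
proof (rule ccontr)
  assume "\<not> z \<sim> y"
  have z: "z \<sim> h" "h \<sim> z" if "h \<in> H" for h
    using assms(2) that adj_commute by (auto simp: common_nbrs_def)
  from assms(1,3-5) obtain a b c d where far: "{a, b, c, d} \<subseteq> H" "a \<sim> b" "c \<sim> d"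
      "a \<parallel> c" "a \<parallel> d" "b \<parallel> c" "b \<parallel> d" "x \<sim> b" "x \<sim> c" "x \<parallel> a" "x \<parallel> d"
    by (rule partial_nbrs_remote_far)
  have y: "y \<parallel> a" "y \<parallel> b" "y \<parallel> c" "y \<parallel> d"
    using far(1) assms(4) by (auto simp: remote_def)
  have "z \<sim> x"
    using assms by (intro common_nbrs_adj_partial_nbrs)
  moreover have "z \<parallel> y"
    using \<open>\<not> z \<sim> y\<close> y z(1)[of a] far(1) adj_commute by auto
  ultimately show False
    using no_whipping_top[of a b x c d y z] far y z assms(5) adj_commute by (metis insert_subset)
qed

text \<open>Remote vertices attached to \<open>H\<close> through common neighbors only are left out
  and stay outside the module.\<close>

definition remote_nbrs :: "'a set \<Rightarrow> 'a set" where
  "remote_nbrs H = {y \<in> remote H. \<exists>x \<in> partial_nbrs H. x \<sim> y}"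

lemma graph_module_hole_closure:
  assumes "hole G H"
  shows "graph_module G (H \<union> partial_nbrs H \<union> remote_nbrs H)" (is "graph_module G ?M")
proof -
  have HV: "H \<subseteq> verts G"
    using assms by (simp add: hole_def)
  have split: "w \<in> ?M \<or> w \<in> common_nbrs H \<or> w \<in> remote H" for w
    by (auto simp: partial_nbrs_def common_nbrs_def remote_def)
  \<comment> \<open>The alternative is a remote \<open>w\<close>. A neighbor \<open>u\<close> in
    \<open>partial_nbrs H\<close> would put \<open>w\<close> into \<open>remote_nbrs H\<close>, and
    a \<open>u\<close> in \<open>remote_nbrs H\<close> passes the adjacency to \<open>w\<close> on
    to its own partial neighbor.\<close>
  have "w \<in> common_nbrs H" if "u \<in> ?M" "w \<notin> ?M" "u \<sim> w" for u w
  proof -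
    have "w \<notin> remote H"
    proof
      assume w: "w \<in> remote H"
      then have "u \<notin> H"
        using that(3) adj_commute by (auto simp: remote_def)
      moreover have no_x: "\<not> x \<sim> w" if "x \<in> partial_nbrs H" for x
        using w that \<open>w \<notin> ?M\<close> by (auto simp: remote_nbrs_def)
      ultimately have "u \<in> remote_nbrs H"
        using that by blast
      then obtain x where "x \<in> partial_nbrs H" "u \<in> remote H" "x \<sim> u"
        by (auto simp: remote_nbrs_def)
      then show False
        using remote_nbr_subset[OF assms, of x u w] no_x that(2,3) by blast
    qed
    then show ?thesis
      using split[of w] that(2) by blast
  qed
  moreover have "u \<sim> w" if "u \<in> ?M" "w \<in> common_nbrs H" for u w
    using that(1)
  proof (elim UnE)
    assume "u \<in> H"
    then show ?thesis
      using that(2) adj_commute by (simp add: common_nbrs_def)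
  next
    assume "u \<in> partial_nbrs H"
    then show ?thesis
      using common_nbrs_adj_partial_nbrs[OF assms that(2)] adj_commute by blast
  next
    assume "u \<in> remote_nbrs H"
    then show ?thesis
      using common_nbrs_adj_remote[OF assms that(2)] adj_commute unfolding remote_nbrs_def by blast
  qed
  ultimately have "{w \<in> verts G - ?M. u \<sim> w} = {w \<in> verts G - ?M. w \<in> common_nbrs H}" if "u \<in> ?M" for u
    using that by blast
  moreover have "?M \<subseteq> verts G"
    using HV by (auto simp: partial_nbrs_def remote_nbrs_def dest: adj_in_verts)
  ultimately show ?thesis
    unfolding graph_module_def by simp
qed

text \<open>The module contains two nonadjacent hole vertices, so it is no clique and cannot be
  proper.\<close>

lemma hole_closure_eq_verts:
  assumes "hole G H" "reduced G"
  shows "H \<union> partial_nbrs H \<union> remote_nbrs H = verts G" (is "?M = _")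
proof (rule ccontr)
  assume ne: "?M \<noteq> verts G"
  have mod: "graph_module G ?M"
    using assms(1) by (rule graph_module_hole_closure)
  then have sub: "?M \<subset> verts G"
    using ne by (auto simp: graph_module_def)
  then have "card ?M < card (verts G)"
    by (intro psubset_card_mono) auto
  moreover have "card H \<le> card ?M"
    using sub by (intro card_mono finite_subset[of ?M "verts G"]) auto
  ultimately have "clique G ?M"
    using mod assms hole_card_ge_4[of H] by (auto simp: reduced_def nontrivial_module_def)
  moreover obtain v p q where "v \<in> H" "p \<in> H" "q \<in> H" "p \<parallel> q"
    using hole_neighbors[OF assms(1)] hole_card_ge_4[OF assms(1)]
    by (metis all_not_in_conv card.empty not_numeral_le_zero)
  ultimately show False
    by (auto simp: clique_def)
qed

lemma common_nbrs_eq_empty: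
  assumes "hole G H" "reduced G"
  shows "common_nbrs H = {}"
proof (rule ccontr)
  assume "common_nbrs H \<noteq> {}"
  then obtain z where z: "z \<in> common_nbrs H"
    by blast
  obtain h where "h \<in> H"
    using hole_card_ge_4[OF assms(1)] by fastforce
  then have "z \<in> verts G"
    using z by (auto simp: common_nbrs_def dest: adj_in_verts)
  then have "z \<in> H \<union> partial_nbrs H \<union> remote_nbrs H"
    using hole_closure_eq_verts[OF assms] by simp
  then show False
    using z \<open>h \<in> H\<close> by (auto simp: common_nbrs_def partial_nbrs_def remote_nbrs_def remote_def)
qed

section \<open>Two holes in a reduced graph\<close>

lemma hole_disjoint_remote:
  assumes "reduced G" "hole G H\<^sub>1" "hole G H\<^sub>2"
  shows "H\<^sub>1 \<inter> remote H\<^sub>2 = {}"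
proof (rule ccontr)
  assume "H\<^sub>1 \<inter> remote H\<^sub>2 \<noteq> {}"
  then obtain v where v: "v \<in> H\<^sub>1" "v \<in> remote H\<^sub>2"
    by blast
  have V: "u \<in> H\<^sub>2 \<union> partial_nbrs H\<^sub>2 \<union> remote_nbrs H\<^sub>2" if "u \<in> H\<^sub>1" for u
    using hole_closure_eq_verts[OF assms(3,1)] assms(2) that by (auto simp: hole_def)
  \<comment> \<open>The vertex following \<open>s\<close> on the hole is apart from
    \<open>u\<close>, whereas \<open>remote_nbr_subset\<close> would make it adjacent to
    \<open>u\<close>.\<close>
  have not_partial: "u \<notin> partial_nbrs H\<^sub>2" if us: "u \<in> H\<^sub>1" "s \<in> H\<^sub>1" "u \<sim> s" "s \<in> remote H\<^sub>2" for u s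
    using hole_next[OF assms(2) us(1-3)] remote_nbr_subset[OF assms(3)] us by metis
  have "H\<^sub>1 \<subseteq> remote H\<^sub>2"
  proof
    fix u assume "u \<in> H\<^sub>1"
    show "u \<in> remote H\<^sub>2"
    proof (rule ccontr)
      assume "u \<notin> remote H\<^sub>2"
      then obtain p q where pq: "p \<in> H\<^sub>1" "q \<in> H\<^sub>1" "p \<sim> q" "p \<notin> remote H\<^sub>2" "q \<in> remote H\<^sub>2"
        using hole_boundary_edge[of H\<^sub>1 u "\<lambda>u. u \<notin> remote H\<^sub>2" v] \<open>u \<in> H\<^sub>1\<close> v assms(2) by metis
      then have "p \<notin> H\<^sub>2"
        using adj_commute by (auto simp: remote_def)
      then have "p \<in> partial_nbrs H\<^sub>2"
        using V[OF pq(1)] pq(4) by (auto simp: remote_nbrs_def)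
      then show False
        using not_partial pq by blast
    qed
  qed
  \<comment> \<open>Being partial, \<open>x\<close> is not remote and so lies off
    \<open>H\<^sub>1\<close>. Its adjacency to \<open>v\<close> then spreads along the edges of
    \<open>H\<^sub>1\<close>, which would make \<open>x\<close> a common neighbor.\<close>
  obtain x where x: "x \<in> partial_nbrs H\<^sub>2" "x \<sim> v"
    using V[OF v(1)] v(2) by (auto simp: remote_nbrs_def remote_def partial_nbrs_def)
  then have "x \<notin> H\<^sub>1"
    using \<open>H\<^sub>1 \<subseteq> remote H\<^sub>2\<close> by (auto simp: remote_def partial_nbrs_def)
  have "x \<sim> t" if t: "t \<in> H\<^sub>1" for t
  proof (rule ccontr)
    assume "\<not> x \<sim> t"
    then obtain p q where pq: "p \<in> H\<^sub>1" "q \<in> H\<^sub>1" "p \<sim> q" "x \<sim> p" "\<not> x \<sim> q"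
      using hole_boundary_edge[of H\<^sub>1 v "\<lambda>u. x \<sim> u" t, OF assms(2) v(1) x(2) t] by metis
    then show False
      using remote_nbr_subset[OF assms(3) x(1), of p q] \<open>H\<^sub>1 \<subseteq> remote H\<^sub>2\<close> \<open>x \<notin> H\<^sub>1\<close> by blast
  qed
  then show False
    using common_nbrs_eq_empty[OF assms(2,1)] by (auto simp: common_nbrs_def)
qed

end

theorem theorem2p2:
  fixes G :: "('a, 'b) pre_digraph" and H\<^sub>1 H\<^sub>2 :: "'a set"
  assumes "graph G"
    and "reduced G"
    and "hole G H\<^sub>1"
    and "hole G H\<^sub>2"
  shows "congenial G H\<^sub>1 H\<^sub>2"
proof -
  interpret prereduced_graph G
    using assms by (simp add: prereduced_graph_def prereduced_graph_axioms_def reduced_def)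
  \<comment> \<open>A vertex outside the closed neighborhood of \<open>H'\<close> is remote from
    \<open>H'\<close>; both orders of the two holes are covered.\<close>
  have "H \<subseteq> closed_nbhd_set G H'" if "hole G H" "hole G H'" for H H'
    using hole_disjoint_remote[OF assms(2) that] adj_commute
    by (fastforce simp: remote_def closed_nbhd_set_def closed_nbhd_def)
  then show ?thesis
    using assms by (simp add: congenial_def)
qed

end
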